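(* Let $s,t>0$ be real numbers and let $G=(V,E)$ be a finite simple graph such that $\|V\|> (s+t+1)|V|$. Then there exists a non-trivial partition $(A,B)$ of $V$ (that is, $A\cup B=V$, $A\cap B=\emptyset$, $A\ne\emptyset$, $B\neq\emptyset$) such that (i) $\|A\|-s|A|> 0$; and (ii) $\|B\|-t|B|> 0$.
   Context: For a graph $G=(V,E)$ and a subset $X\subseteq V$, $|X|$ denotes the number of vertices in $X$ and $\|X\|$ denotes the number of edges of the induced subgraph $G[X]$; in particular $\|V\|=|E|$. Graphs are finite, simple (no loops, no multiple edges) and undirected. A partition $(A,B)$ of $V$ is non-trivial if both parts are non-empty. *)

theory Defs
  imports Complex_Main
begin

text \<open>An edge is the set of its two endpoints, so loops and multiple edges cannot occur.\<close>

definition finite_simple_graph :: "'a set \<Rightarrow> 'a set set \<Rightarrow> bool" where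
  "finite_simple_graph V E \<longleftrightarrow> finite V \<and> (\<forall>e\<in>E. e \<subseteq> V \<and> card e = 2)"

definition induced_edges :: "'a set set \<Rightarrow> 'a set \<Rightarrow> 'a set set" where
  "induced_edges E X = {e \<in> E. e \<subseteq> X}"

definition edge_count :: "'a set set \<Rightarrow> 'a set \<Rightarrow> nat" where
  "edge_count E X = card (induced_edges E X)"

definition nontrivial_partition :: "'a set \<Rightarrow> 'a set \<Rightarrow> 'a set \<Rightarrow> bool" where
  "nontrivial_partition V A B \<longleftrightarrow> A \<union> B = V \<and> A \<inter> B = {} \<and> A \<noteq> {} \<and> B \<noteq> {}"

end

theory Submission
  imports Defs
begin

text \<open>
  Write \<open>n = |V|\<close>, and for \<open>B \<subseteq> V\<close> with \<open>m = |B|\<close> let \<open>D(B)\<close> be the sum over \<open>B\<close> of the degrees in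
  the whole graph.  Deleting a uniformly random vertex from \<open>B\<close> leaves both \<open>D(B) / m\<close> and
  \<open>\<parallel>B\<parallel> / (m (m - 1))\<close> unchanged on average, hence also
  \<open>Z(B) = D(B) / m - (n - 1) \<parallel>B\<parallel> / (m (m - 1))\<close>.
  So, starting from \<open>Z(V) = \<parallel>V\<parallel> / n\<close>, vertices can be deleted one at a time without \<open>Z\<close> ever
  exceeding \<open>\<parallel>V\<parallel> / n\<close> (lemma \<open>exists_Diff_singleton_incidence_excess_nonpos\<close>).

  Suppose that no partition is good, and delete vertices in this way as long as
  \<open>\<parallel>B\<parallel> > t |B|\<close>.  Put \<open>A = V - B\<close>.  While the inequality lasts, \<open>\<parallel>A\<parallel> \<le> s |A|\<close>, so that many
  edges meet \<open>B\<close> and \<open>D(B) = \<parallel>V\<parallel> - \<parallel>A\<parallel> + \<parallel>B\<parallel>\<close> is large compared with \<open>\<parallel>B\<parallel>\<close>.  As \<open>Z(B)\<close> is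
  nevertheless small, \<open>\<parallel>B\<parallel>\<close> itself must be large: more than \<open>(t + 1) (m - 1)\<close>
  (lemma \<open>sparse_complement_imp_dense\<close>).  Deleting one vertex costs at most \<open>m - 1\<close> edges, so
  more than \<open>t (m - 1)\<close> edges are left, and the process never stops.  This is absurd, since a
  single vertex spans no edge.

  To avoid denominators, the proof works with \<open>n m (m - 1) (Z(B) - \<parallel>V\<parallel> / n)\<close>, called
  \<open>incidence_excess\<close>, and instead of running the process it takes the smallest \<open>B\<close> satisfying the
  two inequalities that the process preserves.
\<close>

section \<open>Counting edges and incidences\<close>

definition degree_sum :: "'a set set \<Rightarrow> 'a set \<Rightarrow> nat" where
  "degree_sum E B = (\<Sum>e\<in>E. card (e \<inter> B))"

lemma finite_edges:
  assumes "finite_simple_graph V E"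
  shows "finite E"
proof -
  have "E \<subseteq> Pow V" "finite V"
    using assms by (auto simp: finite_simple_graph_def)
  then show ?thesis
    by (meson finite_Pow_iff finite_subset)
qed

lemma edge_count_eq_sum:
  assumes "finite E"
  shows "edge_count E X = (\<Sum>e\<in>E. if e \<subseteq> X then 1 else 0)"
  using assms by (simp add: edge_count_def induced_edges_def sum.If_cases Int_def)

lemma edge_count_vertices:
  assumes "finite_simple_graph V E"
  shows "edge_count E V = card E"
proof -
  have "induced_edges E V = E"
    using assms by (auto simp: induced_edges_def finite_simple_graph_def)
  then show ?thesis
    by (simp add: edge_count_def)
qed

lemma degree_sum_vertices:
  assumes "finite_simple_graph V E"
  shows "degree_sum E V = 2 * card E"
proof -
  have "card (e \<inter> V) = 2" if "e \<in> E" for e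
    using assms that by (simp add: finite_simple_graph_def Int_absorb2)
  then show ?thesis
    by (simp add: degree_sum_def)
qed

text \<open>An edge meets \<open>B\<close> in \<open>0\<close>, \<open>1\<close> or \<open>2\<close> vertices, according to whether it lies in \<open>V - B\<close>,
  has one end in each part, or lies in \<open>B\<close>; in each case it contributes equally to the two sides.\<close>

lemma degree_sum_add_edge_count_complement:
  assumes G: "finite_simple_graph V E"
  shows "degree_sum E B + edge_count E (V - B) = card E + edge_count E B"
proof -
  have fin: "finite E"
    using finite_edges[OF G] .
  have "card (e \<inter> B) + (if e \<subseteq> V - B then 1 else 0) = 1 + (if e \<subseteq> B then 1 else (0::nat))"
    if "e \<in> E" for e
  proof -
    have "e \<subseteq> V" "card e = 2"
      using G that by (auto simp: finite_simple_graph_def)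
    then obtain x y where "e = {x, y}" "x \<noteq> y" "x \<in> V" "y \<in> V"
      by (auto simp: card_2_iff)
    then show ?thesis
      by (cases "x \<in> B"; cases "y \<in> B") auto
  qed
  then show ?thesis
    unfolding degree_sum_def edge_count_eq_sum[OF fin] card_eq_sum sum.distrib[symmetric]
    by (rule sum.cong[OF refl])
qed

lemma edge_count_le_Diff_singleton:
  assumes G: "finite_simple_graph V E" and "finite B" "v \<in> B"
  shows "edge_count E B \<le> edge_count E (B - {v}) + (card B - 1)"
proof -
  have "induced_edges E B \<subseteq> induced_edges E (B - {v}) \<union> (\<lambda>w. {v, w}) ` (B - {v})"
  proof
    fix e assume e: "e \<in> induced_edges E B"
    then have "card e = 2" "e \<subseteq> B" "e \<in> E"
      using G by (auto simp: induced_edges_def finite_simple_graph_def)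
    then show "e \<in> induced_edges E (B - {v}) \<union> (\<lambda>w. {v, w}) ` (B - {v})"
      by (auto simp: induced_edges_def card_2_iff)
  qed
  moreover have "finite (induced_edges E (B - {v}))"
    using finite_edges[OF G] by (simp add: induced_edges_def)
  ultimately have "edge_count E B \<le> edge_count E (B - {v}) + card ((\<lambda>w. {v, w}) ` (B - {v}))"
    unfolding edge_count_def
    using \<open>finite B\<close> by (meson card_Un_le card_mono finite_Diff finite_UnI finite_imageI le_trans)
  moreover have "card ((\<lambda>w. {v, w}) ` (B - {v})) \<le> card B - 1"
    using card_image_le[of "B - {v}"] assms by (metis card_Diff_singleton finite_Diff)
  ultimately show ?thesis
    by linarith
qed

section \<open>Averaging over the deletion of one vertex\<close>

lemma sum_degree_sum_Diff_singleton:
  assumes "finite B"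
  shows "(\<Sum>v\<in>B. real (degree_sum E (B - {v}))) = (real (card B) - 1) * real (degree_sum E B)"
proof -
  have "(\<Sum>v\<in>B. real (card (e \<inter> (B - {v})))) = (real (card B) - 1) * real (card (e \<inter> B))" for e
  proof -
    have "real (card (e \<inter> (B - {v}))) = real (card (e \<inter> B)) - (if v \<in> e then 1 else 0)"
      if "v \<in> B" for v
    proof (cases "v \<in> e")
      case True
      then have "v \<in> e \<inter> B" "e \<inter> (B - {v}) = e \<inter> B - {v}"
        using that by auto
      then have "card (e \<inter> B) = Suc (card (e \<inter> (B - {v})))"
        using assms by (metis card_Suc_Diff1 finite_Int)
      then show ?thesis
        using True by simp
    next
      case False
      then have "e \<inter> (B - {v}) = e \<inter> B"
        by auto
      then show ?thesis
        using False by simp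
    qed
    then have "(\<Sum>v\<in>B. real (card (e \<inter> (B - {v}))))
        = (\<Sum>v\<in>B. real (card (e \<inter> B)) - (if v \<in> e then 1 else 0))"
      by simp
    also have "\<dots> = real (card B) * real (card (e \<inter> B)) - real (card (e \<inter> B))"
      using assms by (simp add: sum_subtractf sum.If_cases Int_commute)
    finally show ?thesis
      by (simp add: algebra_simps)
  qed
  then show ?thesis
    by (simp add: degree_sum_def sum.swap[of _ E B] sum_distrib_left)
qed

lemma sum_edge_count_Diff_singleton:
  assumes G: "finite_simple_graph V E" and "finite B"
  shows "(\<Sum>v\<in>B. real (edge_count E (B - {v}))) = (real (card B) - 2) * real (edge_count E B)"
proof -
  have "(\<Sum>v\<in>B. if e \<subseteq> B - {v} then 1 else (0::real)) =
      (real (card B) - 2) * (if e \<subseteq> B then 1 else 0)" if "e \<in> E" for e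
  proof (cases "e \<subseteq> B")
    case True
    have "card e = 2" "finite e"
      using G that True assms(2) by (auto simp: finite_simple_graph_def finite_subset)
    have "{v \<in> B. e \<subseteq> B - {v}} = B - e"
      using True by auto
    moreover have "card (B - e) + 2 = card B"
      using True \<open>card e = 2\<close> \<open>finite e\<close> assms(2)
      by (metis card_Diff_subset card_mono le_add_diff_inverse2)
    ultimately have "real (card {v \<in> B. e \<subseteq> B - {v}}) = real (card B) - 2"
      by simp
    then show ?thesis
      using True assms(2) by (simp add: sum.If_cases Int_def)
  next
    case False
    then have "\<not> e \<subseteq> B - {v}" for v
      by auto
    then show ?thesis
      using False by simp
  qed
  then have "(\<Sum>e\<in>E. \<Sum>v\<in>B. if e \<subseteq> B - {v} then 1 else (0::real)) =
      (\<Sum>e\<in>E. (real (card B) - 2) * (if e \<subseteq> B then 1 else 0))"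
    by (rule sum.cong[OF refl])
  moreover have "real (edge_count E X) = (\<Sum>e\<in>E. if e \<subseteq> X then 1 else 0)" for X
    using finite_edges[OF G] by (simp add: edge_count_eq_sum sum.If_cases)
  ultimately show ?thesis
    by (simp add: sum.swap[of _ E B] sum_distrib_left)
qed

text \<open>The excess is \<open>n m (m - 1) (Z(B) - \<parallel>V\<parallel> / n)\<close> in the notation of the introduction.  Clearing
  denominators makes it meaningful for a single vertex too, where it is \<open>0\<close>, so the step from two
  vertices to one is not a special case.\<close>

definition incidence_excess :: "'a set \<Rightarrow> 'a set set \<Rightarrow> 'a set \<Rightarrow> real" where
  "incidence_excess V E B =
    real (card V) * ((real (card B) - 1) * real (degree_sum E B)
      - (real (card V) - 1) * real (edge_count E B))
    - real (card E) * (real (card B) * (real (card B) - 1))"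

lemma incidence_excess_vertices:
  assumes "finite_simple_graph V E"
  shows "incidence_excess V E V = 0"
  by (simp add: incidence_excess_def edge_count_vertices[OF assms] degree_sum_vertices[OF assms]
      algebra_simps)

text \<open>Since \<open>Z\<close> is preserved on average and the factor \<open>m (m - 1)\<close> becomes \<open>(m - 1) (m - 2)\<close>, the
  average excess over the \<open>m\<close> deletions is the old one times \<open>(m - 2) / m\<close>.\<close>

lemma sum_incidence_excess_Diff_singleton:
  assumes G: "finite_simple_graph V E" and "finite B"
  shows "(\<Sum>v\<in>B. incidence_excess V E (B - {v})) = (real (card B) - 2) * incidence_excess V E B"
proof -
  have "incidence_excess V E (B - {v}) =
      real (card V) * (real (card B) - 2) * real (degree_sum E (B - {v}))
      - real (card V) * (real (card V) - 1) * real (edge_count E (B - {v}))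
      - real (card E) * (real (card B) - 1) * (real (card B) - 2)" if "v \<in> B" for v
  proof -
    have card_v: "real (card (B - {v})) = real (card B) - 1"
      using card_Suc_Diff1[OF assms(2) that] by linarith
    show ?thesis
      unfolding incidence_excess_def card_v by (simp add: algebra_simps)
  qed
  then have "(\<Sum>v\<in>B. incidence_excess V E (B - {v})) =
      real (card V) * (real (card B) - 2) * (\<Sum>v\<in>B. real (degree_sum E (B - {v})))
      - real (card V) * (real (card V) - 1) * (\<Sum>v\<in>B. real (edge_count E (B - {v})))
      - real (card B) * (real (card E) * (real (card B) - 1) * (real (card B) - 2))"
    by (simp add: sum_subtractf sum_distrib_left)
  also have "\<dots> = (real (card B) - 2) * incidence_excess V E B"
    unfolding sum_degree_sum_Diff_singleton[OF assms(2)] sum_edge_count_Diff_singleton[OF assms]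
    by (simp add: incidence_excess_def algebra_simps)
  finally show ?thesis .
qed

lemma exists_Diff_singleton_incidence_excess_nonpos:
  assumes "finite_simple_graph V E" "finite B" "2 \<le> card B" "incidence_excess V E B \<le> 0"
  obtains v where "v \<in> B" "incidence_excess V E (B - {v}) \<le> 0"
proof -
  have "\<exists>v\<in>B. incidence_excess V E (B - {v}) \<le> 0"
  proof (rule ccontr)
    assume "\<not> ?thesis"
    then have "0 < (\<Sum>v\<in>B. incidence_excess V E (B - {v}))"
      using assms by (intro sum_pos) (auto simp: not_le)
    moreover have "(real (card B) - 2) * incidence_excess V E B \<le> 0"
      using assms by (intro mult_nonneg_nonpos) auto
    ultimately show False
      using sum_incidence_excess_Diff_singleton[OF assms(1,2)] by simp
  qed
  then show thesis
    using that by blast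
qed

section \<open>Existence of the partition\<close>

text \<open>A sparse complement gives a lower bound on \<open>D(B)\<close>, and nonpositive excess an upper bound in
  terms of \<open>\<parallel>B\<parallel>\<close>.  After substitution, both \<open>\<parallel>V\<parallel>\<close> and \<open>\<parallel>B\<parallel>\<close> carry the factor \<open>|V - B|\<close>, which
  cancels unless \<open>B = V\<close>; this is what the weight \<open>|V| - 1\<close> in the excess is for.\<close>

lemma sparse_complement_imp_dense:
  fixes s t :: real
  assumes G: "finite_simple_graph V E" and "B \<subseteq> V" "2 \<le> card B" "0 \<le> s" "0 \<le> t"
    and dense: "real (card E) > (s + t + 1) * real (card V)"
    and excess: "incidence_excess V E B \<le> 0"
    and sparse: "real (edge_count E (V - B)) \<le> s * real (card (V - B))"
  shows "real (edge_count E B) > (t + 1) * (real (card B) - 1)"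
proof (cases "B = V")
  case True
  have "(t + 1) * (real (card B) - 1) \<le> (s + t + 1) * real (card V)"
    using True assms by (intro mult_mono) auto
  then show ?thesis
    using True dense edge_count_vertices[OF G] by simp
next
  case False
  have "finite V"
    using G by (simp add: finite_simple_graph_def)
  define n m a b c where "n = real (card V)" and "m = real (card B)"
    and "a = real (edge_count E (V - B))" and "b = real (edge_count E B)" and "c = real (card E)"
  note names = n_def m_def a_def b_def c_def
  have "m < n"
    using False \<open>finite V\<close> \<open>B \<subseteq> V\<close> by (simp add: names psubset_card_mono psubsetI)
  have "m \<ge> 2"
    using assms by (simp add: names)
  have complement: "real (card (V - B)) = n - m"
    using \<open>finite V\<close> \<open>B \<subseteq> V\<close> by (simp add: names card_Diff_subset finite_subset card_mono of_nat_diff)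
  have "real (degree_sum E B + edge_count E (V - B)) = real (card E + edge_count E B)"
    using degree_sum_add_edge_count_complement[OF G, of B] by (rule arg_cong)
  then have "real (degree_sum E B) = c + b - a"
    by (simp add: names)
  then have "n * ((m - 1) * (c + b - a) - (n - 1) * b) - c * (m * (m - 1)) \<le> 0"
    using excess by (simp add: incidence_excess_def names)
  then have "(m - 1) * c * (n - m) - n * (m - 1) * a \<le> n * b * (n - m)"
    by (simp add: algebra_simps)
  moreover have "n * (m - 1) * a \<le> n * (m - 1) * (s * (n - m))"
    using sparse \<open>m < n\<close> \<open>m \<ge> 2\<close> complement by (intro mult_left_mono) (auto simp: names)
  ultimately have "(m - 1) * (c - s * n) * (n - m) \<le> n * b * (n - m)"
    by (simp add: algebra_simps)
  then have "(m - 1) * (c - s * n) \<le> n * b"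
    using \<open>m < n\<close> by simp
  moreover have "(m - 1) * ((t + 1) * n) < (m - 1) * (c - s * n)"
    using dense \<open>m \<ge> 2\<close> by (intro mult_strict_left_mono) (auto simp: names algebra_simps)
  ultimately have "n * ((t + 1) * (m - 1)) < n * b"
    by (simp add: algebra_simps)
  then show ?thesis
    using \<open>m < n\<close> \<open>m \<ge> 2\<close> by (simp add: names mult_less_cancel_left_pos)
qed

theorem theorem1:
  fixes V :: "'a set" and E :: "'a set set" and s t :: real
  assumes "finite_simple_graph V E"
    and "s > 0" and "t > 0"
    and "real (edge_count E V) > (s + t + 1) * real (card V)"
  shows "\<exists>A B. nontrivial_partition V A B
    \<and> real (edge_count E A) - s * real (card A) > 0
    \<and> real (edge_count E B) - t * real (card B) > 0"
proof (rule ccontr)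
  assume no_partition: "\<not> ?thesis"
  have "finite V"
    using assms(1) by (simp add: finite_simple_graph_def)
  have dense: "real (card E) > (s + t + 1) * real (card V)"
    using assms(4) edge_count_vertices[OF assms(1)] by simp
  have nonempty: "X \<noteq> {}" if "real (edge_count E X) > r * real (card X)" for X and r :: real
  proof
    assume "X = {}"
    moreover have "induced_edges E {} = {}"
      using assms(1) by (auto simp: induced_edges_def finite_simple_graph_def)
    ultimately show False
      using that by (simp add: edge_count_def)
  qed
  have sparse: "real (edge_count E (V - B)) \<le> s * real (card (V - B))"
    if "B \<subseteq> V" "real (edge_count E B) > t * real (card B)" for B
  proof (rule ccontr)
    assume "\<not> ?thesis"
    then have "real (edge_count E (V - B)) > s * real (card (V - B))"
      by simp
    moreover from this have "nontrivial_partition V (V - B) B"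
      using that nonempty by (fastforce simp: nontrivial_partition_def)
    ultimately show False
      using no_partition that by auto
  qed
  \<comment> \<open>The candidates are the sets through which the deletion process may pass.\<close>
  define candidate where "candidate B \<longleftrightarrow> B \<subseteq> V \<and> incidence_excess V E B \<le> 0
    \<and> real (edge_count E B) > t * real (card B)" for B
  have "t * real (card V) \<le> (s + t + 1) * real (card V)"
    using assms by (intro mult_right_mono) auto
  then have "candidate V"
    using assms(4) incidence_excess_vertices[OF assms(1)] by (simp add: candidate_def)
  then obtain B where "candidate B" and minimal: "\<And>C. candidate C \<Longrightarrow> card B \<le> card C"
    using ex_has_least_nat[of candidate V card] by blast
  then have B: "B \<subseteq> V" "incidence_excess V E B \<le> 0"
    "real (edge_count E B) > t * real (card B)"
    by (auto simp: candidate_def)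
  have "finite B"
    using B(1) \<open>finite V\<close> by (rule finite_subset)
  have "edge_count E B > 0"
    using B(3) assms(3) by (smt (verit) mult_nonneg_nonneg of_nat_0_le_iff of_nat_0_less_iff)
  then obtain e where "e \<in> E" "e \<subseteq> B"
    unfolding edge_count_def induced_edges_def card_gt_0_iff by blast
  then have "2 \<le> card B"
    using assms(1) card_mono[OF \<open>finite B\<close>] by (metis finite_simple_graph_def)
  then obtain v where v: "v \<in> B" "incidence_excess V E (B - {v}) \<le> 0"
    using exists_Diff_singleton_incidence_excess_nonpos[OF assms(1) \<open>finite B\<close> _ B(2)] by blast
  have card_v: "real (card (B - {v})) = real (card B) - 1"
    using card_Suc_Diff1[OF \<open>finite B\<close> v(1)] by linarith
  \<comment> \<open>The surplus of \<open>card B - 1\<close> edges over \<open>t * (card B - 1)\<close> pays for the deletion of \<open>v\<close>.\<close>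
  have "real (edge_count E B) > (t + 1) * (real (card B) - 1)"
    using assms B sparse[OF B(1,3)] \<open>2 \<le> card B\<close> dense
    by (intro sparse_complement_imp_dense) auto
  moreover have "real (edge_count E B) \<le> real (edge_count E (B - {v})) + (real (card B) - 1)"
    using edge_count_le_Diff_singleton[OF assms(1) \<open>finite B\<close> v(1)] \<open>2 \<le> card B\<close> by linarith
  ultimately have "real (edge_count E (B - {v})) > t * real (card (B - {v}))"
    by (simp add: card_v algebra_simps)
  then have "candidate (B - {v})"
    using B(1) v(2) by (auto simp: candidate_def)
  then show False
    using minimal[of "B - {v}"] card_v by linarith
qed

end
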